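(* Let $F=0$, $\hat p<0$, let $\hat L(X)$ be a monotonically increasing function, and let $X=d>0$ be the unique positive fixed solution of the scalar autonomous equation $\dot X=\hat pX+\hat k\hat L(X)$. Let $x(t,x_0)$ denote the solution of $\dot x=A(t)x+f(t,x)$, $x(t_0,x_0)=x_0$. (1) If the fixed solution $X=d$ is unstable, then the solution $x=0$ of $\dot x=A(t)x+f(t,x)$ is asymptotically stable. Furthermore, if $x_0\in\omega(t_0,d)$, then $\|x(t,x_0)\|\le d$ for all $t\ge t_0$ and $\lim_{t\to\infty}\|x(t,x_0)\|=0$, i.e., $\omega(t_0,d)$ belongs to the stability basin of the solution $x=0$. (2) If $X=d$ is a stable solution of $\dot X=\hat pX+\hat k\hat L(X)$, then $\|x(t,x_0)\|\le d$ for all $t\ge t_0$ and all $x_0\in\omega(t_0,d)$, and $\limsup_{t\to\infty}\|x(t,x_0)\|\le d$ for all $x_0\in\mathbb{R}^n$, i.e., $\omega(t_0,d)$ belongs to the trapping region of the solution $x=0$.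
   Context: Here $t\in[t_0,\infty)$, $x\in\mathbb{R}^n$, $f(t,0)=0$; $A(t)\in\mathbb{R}^{n\times n}$ and $f:[t_0,\infty)\times\mathbb{R}^n\to\mathbb{R}^n$ are continuous and bounded, and $A$ is continuously differentiable. $F(t)$ is the (here identically zero) forcing term in the general system $\dot x=A(t)x+f(t,x)+F(t)$. Solutions of initial value problems at $t_0$ are assumed to be uniquely defined for all $t\ge t_0$. $\|\cdot\|$ is the Euclidean norm for vectors and the induced (spectral) norm for matrices. $W(t)$ is a fundamental solution matrix of $\dot x=A(t)x$ with $\|W(t_0)\|=1$; $\sigma_{\max}(t)$, $\sigma_{\min}(t)$ are its largest and smallest singular values; $\sigma_{\max}(t)$ is unique (simple) for every $t\ge t_0$, and $\sup_{t\ge t_0}\sigma_{\max}\le\bar\sigma$, $\inf_{t\ge t_0}\sigma_{\min}\ge\underline\sigma$ for constants $\bar\sigma,\underline\sigma$. Definitions: $p(t)=\frac{d}{dt}\ln\|W(t)\|$ (continuous), $k(t)=\|W(t)\|\,\|W^{-1}(t)\|$ (continuous and bounded). Nonlinear Lipschitz inequality: $\|f(t,x)\|\le L(t,\|x\|)$ for all $x\in\Omega$, $t\ge t_0$, where $\Omega$ is a neighborhood of $x=0$ and $L$ is continuous in $t$ and $\|x\|$; the solutions considered are those staying in $\Omega$ (automatic if $\Omega=\mathbb{R}^n$). The auxiliary equation $\dot X=p(t)X+k(t)L(t,X)$ is assumed to have a unique solution for every initial value $X(t_0)=X_0\ge0$, for all $t\ge t_0$. Set $\hat p=\sup_{t\ge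 t_0}p(t)$, $\hat k=\sup_{t\ge t_0}k(t)$, $\hat L(X)=\sup_{t\ge t_0}L(t,X)$; these are assumed finite, with $\hat L(0)=0$, and the equation $\dot X=\hat pX+\hat k\hat L(X)$ is assumed to have unique solutions, extendable to all $t\ge t_0$, for the relevant initial values. $\omega(t_0,d)=\{x_0\in\mathbb{R}^n:\|W^{-1}(t_0)x_0\|\le d\}$. The stability basin of $x=0$ is the set of $x_0$ with $x(t,x_0)\to0$; the phrase "belongs to the trapping region" in (2) means exactly the stated bounds.
   Formalization: The English fails in corner cases. In (1) "unstable" means not stable from below (so a semistable d is excluded), and convergence to 0 is claimed only for ‖W⁻¹(t₀)x₀‖<d, not on the boundary of ω(t₀,d); L̂ is assumed continuous throughout. *)

theory Defs
  imports "HOL-Analysis.Analysis"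
begin

text \<open>Forward solutions of \<open>y' = rhs t y\<close> on \<open>[t0, \<infinity>)\<close> that live in the state set \<open>S\<close>
  (derivative at \<open>t0\<close> one-sided). Values at \<open>t < t0\<close> are irrelevant.\<close>

definition solves_ode ::
  "(real \<Rightarrow> 'a \<Rightarrow> 'a::real_normed_vector) \<Rightarrow> real \<Rightarrow> 'a set \<Rightarrow> (real \<Rightarrow> 'a) \<Rightarrow> bool" where
  "solves_ode rhs t0 S y \<longleftrightarrow>
     (\<forall>t\<ge>t0. y t \<in> S \<and> (y has_vector_derivative rhs t (y t)) (at t within {t0..}))"

definition uniquely_solvable ::
  "(real \<Rightarrow> 'a \<Rightarrow> 'a::real_normed_vector) \<Rightarrow> real \<Rightarrow> 'a set \<Rightarrow> bool" where
  "uniquely_solvable rhs t0 S \<longleftrightarrow>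
     (\<forall>y0\<in>S. \<exists>y. solves_ode rhs t0 S y \<and> y t0 = y0 \<and>
        (\<forall>z. solves_ode rhs t0 S z \<and> z t0 = y0 \<longrightarrow> (\<forall>t\<ge>t0. z t = y t)))"

definition fixed_solution ::
  "(real \<Rightarrow> 'a \<Rightarrow> 'a::real_normed_vector) \<Rightarrow> real \<Rightarrow> 'a set \<Rightarrow> 'a \<Rightarrow> bool" where
  "fixed_solution rhs t0 S c \<longleftrightarrow> solves_ode rhs t0 S (\<lambda>_. c)"

text \<open>Lyapunov stability of a solution \<open>u\<close> with respect to perturbed initial values in \<open>P\<close>.
  The usual notion is \<open>P = S\<close>. A smaller \<open>P\<close> gives one-sided notions, which are needed because
  an equilibrium of a scalar equation can be semistable, that is, stable from one side only.\<close>

definition stable_solution ::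
  "(real \<Rightarrow> 'a \<Rightarrow> 'a::real_normed_vector) \<Rightarrow> real \<Rightarrow> 'a set \<Rightarrow> 'a set \<Rightarrow> (real \<Rightarrow> 'a) \<Rightarrow> bool" where
  "stable_solution rhs t0 S P u \<longleftrightarrow>
     (\<forall>\<epsilon>>0. \<exists>\<delta>>0. \<forall>y. solves_ode rhs t0 S y \<and> y t0 \<in> P \<and> dist (y t0) (u t0) < \<delta>
        \<longrightarrow> (\<forall>t\<ge>t0. dist (y t) (u t) < \<epsilon>))"

definition asymptotically_stable_solution ::
  "(real \<Rightarrow> 'a \<Rightarrow> 'a::real_normed_vector) \<Rightarrow> real \<Rightarrow> 'a set \<Rightarrow> (real \<Rightarrow> 'a) \<Rightarrow> bool" where
  "asymptotically_stable_solution rhs t0 S u \<longleftrightarrow>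
     stable_solution rhs t0 S S u \<and>
     (\<exists>\<eta>>0. \<forall>y. solves_ode rhs t0 S y \<and> dist (y t0) (u t0) < \<eta>
        \<longrightarrow> ((\<lambda>t. dist (y t) (u t)) \<longlongrightarrow> 0) at_top)"

text \<open>\<open>norm\<close> on \<open>real^'n^'n\<close> is the Frobenius norm, so the spectral norm is written with
  \<open>onorm\<close>.\<close>

definition spectral_norm :: "real^'n^'n \<Rightarrow> real" where
  "spectral_norm M = onorm ((*v) M)"

definition fundamental_matrix ::
  "(real \<Rightarrow> real^'n^'n) \<Rightarrow> real \<Rightarrow> (real \<Rightarrow> real^'n^'n) \<Rightarrow> bool" where
  "fundamental_matrix A t0 W \<longleftrightarrow>
     (\<forall>t\<ge>t0. (W has_vector_derivative A t ** W t) (at t within {t0..}) \<and> invertible (W t))"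

definition right_singular_space :: "real^'n^'n \<Rightarrow> real \<Rightarrow> (real^'n) set" where
  "right_singular_space M s = {v. (transpose M ** M) *v v = s\<^sup>2 *\<^sub>R v}"

definition singular_values :: "real^'n^'n \<Rightarrow> real set" where
  "singular_values M = {s. 0 \<le> s \<and> (\<exists>v\<in>right_singular_space M s. v \<noteq> 0)}"

definition sigma_max :: "real^'n^'n \<Rightarrow> real" where
  "sigma_max M = Max (singular_values M)"

definition sigma_min :: "real^'n^'n \<Rightarrow> real" where
  "sigma_min M = Min (singular_values M)"

text \<open>The multiplicity of a singular value \<open>s\<close> of \<open>M\<close> is the multiplicity of the eigenvalue
  \<open>s\<^sup>2\<close> of the symmetric matrix \<open>M\<^sup>T M\<close>, which is the dimension of its eigenspace.\<close>

definition sigma_max_simple :: "real^'n^'n \<Rightarrow> bool" where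
  "sigma_max_simple M \<longleftrightarrow> dim (right_singular_space M (sigma_max M)) = 1"

definition omega :: "(real \<Rightarrow> real^'n^'n) \<Rightarrow> real \<Rightarrow> real \<Rightarrow> (real^'n) set" where
  "omega W t0 d = {x0. norm (matrix_inv (W t0) *v x0) \<le> d}"

text \<open>The argument \<open>x\<close> is the solution map \<open>x t x0\<close>.\<close>

definition stability_basin :: "(real \<Rightarrow> real^'n \<Rightarrow> real^'n) \<Rightarrow> (real^'n) set" where
  "stability_basin x = {x0. ((\<lambda>t. x t x0) \<longlongrightarrow> 0) at_top}"

end

theory Submission
  imports Defs
begin

text \<open>Write a solution \<open>y\<close> of the system as \<open>y = W c\<close>. Variation of constants gives \<open>c' = W\<^sup>-\<^sup>1 f\<close>, so the
norm of \<open>y t\<close> is bounded by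
\<open>X t = |W t| (|c t0| + \<integral> |W\<^sup>-\<^sup>1| |f|)\<close>, and this scalar function satisfies
\<open>X' = p X + k |f|\<close>. As long as \<open>y\<close> stays in \<open>\<Omega>\<close>, the bounds on \<open>p\<close>, \<open>k\<close>, \<open>f\<close> and the
monotonicity of \<open>Lhat\<close> yield the autonomous differential inequality \<open>X' \<le> g X\<close> with
\<open>g X = phat X + khat Lhat X\<close>. The initial value \<open>X t0\<close> is the norm of \<open>W t0\<^sup>-\<^sup>1 (y t0)\<close>, because
\<open>W t0\<close> has norm \<open>1\<close>; thus \<open>omega W t0 d\<close> is exactly the condition \<open>X t0 \<le> d\<close>. This reduction is
\<open>scalar_majorant\<close>, and everything else concerns the scalar inequality.

As \<open>d\<close> is the only positive zero of \<open>g\<close>, the sign of \<open>g\<close> is constant on each side of \<open>d\<close>.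
Instability from below forces \<open>g < 0\<close> on the interval from \<open>0\<close> to \<open>d\<close>
(\<open>unstable_imp_negative_below\<close>), and stability forces \<open>g < 0\<close> above \<open>d\<close>
(\<open>stable_imp_negative_above\<close>). Where \<open>g\<close> is negative \<open>X\<close> cannot climb and is pushed down to the next
zero of \<open>g\<close> (\<open>eventually_le_level\<close>). In the unstable case this zero is \<open>0\<close>, which gives asymptotic
stability and attraction of every solution in \<open>\<Omega>\<close> with \<open>X t0 < d\<close>; in the stable case it is \<open>d\<close>, which gives the
bound on the limit superior.

The remaining claim, that \<open>X t0 \<le> d\<close> implies \<open>X t \<le> d\<close> for solutions staying in \<open>\<Omega>\<close>, is the same in both cases and is proved in
\<open>never_above_equilibrium\<close>. It is immediate if \<open>g < 0\<close> above \<open>d\<close>. If \<open>g > 0\<close> above \<open>d\<close>, the threat is a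
majorant that starts at \<open>d\<close> exactly and escapes upwards. Unique solvability excludes this: solutions
starting slightly above \<open>d\<close> converge to the constant solution \<open>d\<close>
(\<open>solutions_decrease_to_equilibrium\<close>), and run at double speed they bound \<open>X\<close> from above.\<close>

section \<open>Crossing levels with a controlled derivative\<close>

text \<open>Cutting at the first time the level \<open>m\<close> is reached, and then at the last earlier time at which
the value is at most \<open>c\<close>, leaves an excursion that stays strictly between the two levels.
Differential inequalities known only on a strip of values can then be used on that excursion.\<close>

lemma crossing_interval:
  fixes X :: "real \<Rightarrow> real"
  assumes cont: "continuous_on {a..b} X" and "a \<le> b" "X a \<le> c" "c < m" "m \<le> X b"
  obtains s t where "a \<le> s" "s < t" "t \<le> b" "X s \<le> c" "m \<le> X t"
    "\<And>u. s < u \<Longrightarrow> u < t \<Longrightarrow> c < X u \<and> X u < m"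
proof -
  have "closed {u \<in> {a..b}. m \<le> X u}"
    by (intro continuous_on_closed_Collect_le cont continuous_intros)
  then have "compact ({a..b} \<inter> {u \<in> {a..b}. m \<le> X u})"
    by (intro compact_Int_closed) auto
  then have "compact {u \<in> {a..b}. m \<le> X u}"
    by (simp add: Int_def conj_ac)
  moreover have "{u \<in> {a..b}. m \<le> X u} \<noteq> {}"
    using assms by auto
  ultimately obtain t where t: "a \<le> t" "t \<le> b" "m \<le> X t"
    and t_first: "\<And>u. a \<le> u \<Longrightarrow> u < t \<Longrightarrow> X u < m"
    using compact_attains_inf[of "{u \<in> {a..b}. m \<le> X u}"] by fastforce
  have cont_t: "continuous_on {a..t} X"
    by (rule continuous_on_subset[OF cont]) (use t in auto)
  have "closed {u \<in> {a..t}. X u \<le> c}"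
    by (intro continuous_on_closed_Collect_le cont_t continuous_intros)
  then have "compact ({a..t} \<inter> {u \<in> {a..t}. X u \<le> c})"
    by (intro compact_Int_closed) auto
  then have "compact {u \<in> {a..t}. X u \<le> c}"
    by (simp add: Int_def conj_ac)
  moreover have "{u \<in> {a..t}. X u \<le> c} \<noteq> {}"
    using assms t by auto
  ultimately obtain s where s: "s \<in> {a..t}" "X s \<le> c"
    and s_max: "\<And>u. u \<in> {a..t} \<Longrightarrow> X u \<le> c \<Longrightarrow> u \<le> s"
    using compact_attains_sup[of "{u \<in> {a..t}. X u \<le> c}"] by blast
  have s_last: "c < X u" if "s < u" "u \<le> t" for u
    using s_max[of u] s that by force
  have "s \<noteq> t" using s t \<open>c < m\<close> by auto
  then show thesis
    using that[of s t] s t s_last t_first by auto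
qed

lemma continuous_on_half_line:
  fixes X :: "real \<Rightarrow> real"
  assumes "\<And>t. t \<ge> t0 \<Longrightarrow> (X has_real_derivative X' t) (at t within {t0..})"
  shows "continuous_on {t0..} X"
  using assms by (auto intro!: DERIV_continuous_on)

lemma mean_value_half_line:
  fixes X :: "real \<Rightarrow> real"
  assumes deriv: "\<And>t. t \<ge> t0 \<Longrightarrow> (X has_real_derivative X' t) (at t within {t0..})"
    and "t0 \<le> s" "s < t"
  obtains \<xi> where "s < \<xi>" "\<xi> < t" "X t - X s = (t - s) * X' \<xi>"
proof -
  have "continuous_on {s..t} X"
    by (rule continuous_on_subset[OF continuous_on_half_line[OF deriv]]) (use assms in auto)
  moreover have "(X has_real_derivative X' u) (at u)" if "s < u" for u
  proof -
    have "u \<in> interior {t0..}" using that assms by simp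
    then have "at u within {t0..} = at u" by (rule at_within_interior)
    then show ?thesis using deriv[of u] that assms by simp
  qed
  ultimately obtain \<xi> where "s < \<xi>" "\<xi> < t" "X t - X s = X' \<xi> * (t - s)"
    using mvt[of s t X "\<lambda>u h. X' u * h"] \<open>s < t\<close>
    by (auto simp: has_field_derivative_def)
  then show thesis using that by (simp add: mult.commute)
qed

text \<open>The mean value theorem on the excursion. This is the form in which differential inequalities are
used below: a bound on \<open>X'\<close> that excludes \<open>X' > 0\<close> while \<open>X\<close> lies in a strip makes it impossible
to climb through the strip. Applied to \<open>-X\<close> it excludes descents.\<close>

lemma up_crossing:
  fixes X :: "real \<Rightarrow> real"
  assumes deriv: "\<And>t. t \<ge> t0 \<Longrightarrow> (X has_real_derivative X' t) (at t within {t0..})"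
    and "t0 \<le> a" "a \<le> b" "X a \<le> c" "c < m" "m \<le> X b"
  obtains \<xi> where "a < \<xi>" "\<xi> < b" "c < X \<xi>" "X \<xi> < m" "X' \<xi> > 0"
proof -
  have "continuous_on {a..b} X"
    by (rule continuous_on_subset[OF continuous_on_half_line[OF deriv]]) (use assms in auto)
  then obtain s t where st: "a \<le> s" "s < t" "t \<le> b" "X s \<le> c" "m \<le> X t"
    "\<And>u. s < u \<Longrightarrow> u < t \<Longrightarrow> c < X u \<and> X u < m"
    by (rule crossing_interval) (use assms in auto)
  have "t0 \<le> s" using st assms by simp
  obtain \<xi> where \<xi>: "s < \<xi>" "\<xi> < t" "X t - X s = (t - s) * X' \<xi>"
    by (rule mean_value_half_line[OF deriv \<open>t0 \<le> s\<close> \<open>s < t\<close>])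
  then have "0 < (t - s) * X' \<xi>"
    using st assms by linarith
  then have "X' \<xi> > 0"
    using st by (simp add: zero_less_mult_iff)
  then show thesis using that[of \<xi>] \<xi> st by auto
qed

text \<open>While \<open>X\<close> lies in the strip between \<open>a\<close> and \<open>b\<close> it cannot climb, and in a compact part
\<open>{c'..X t0}\<close> of the strip it falls at a rate bounded away from zero, namely at least the distance
from \<open>0\<close> of the maximum of \<open>g\<close> there. It must therefore fall below \<open>c'\<close> in finite time, and it
stays below afterwards.\<close>

lemma eventually_le_level:
  fixes X g :: "real \<Rightarrow> real"
  assumes deriv: "\<And>t. t \<ge> t0 \<Longrightarrow> (X has_real_derivative X' t) (at t within {t0..})"
    and le: "\<And>t. t \<ge> t0 \<Longrightarrow> X' t \<le> g (X t)"
    and cont: "continuous_on {a<..<b} g"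
    and neg: "\<And>u. a < u \<Longrightarrow> u < b \<Longrightarrow> g u < 0"
    and init: "X t0 < b" and "a < b" "a < c"
  shows "\<forall>\<^sub>F t in at_top. X t \<le> c"
proof -
  have barrier: "X t \<le> e" if st: "t0 \<le> s" "s \<le> t" "X s \<le> e" and e: "a < e" "e < b" for s t e
  proof (rule ccontr)
    assume "\<not> X t \<le> e"
    \<comment> \<open>The cap \<open>b\<close> keeps the crossing value inside the strip where \<open>g\<close> is negative.\<close>
    then have up: "e < min b (X t)" using e by simp
    obtain \<xi> where \<xi>: "s < \<xi>" "\<xi> < t" "e < X \<xi>" "X \<xi> < min b (X t)" "X' \<xi> > 0"
      by (rule up_crossing[OF deriv st up]) auto
    then show False using le[of \<xi>] neg[of "X \<xi>"] st e by auto
  qed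
  define c' where "c' = min c ((a + b) / 2)"
  show ?thesis
  proof -
    have c': "a < c'" "c' < b" "c' \<le> c"
      using \<open>a < c\<close> \<open>a < b\<close> by (auto simp: c'_def min_def field_simps)
    have "\<exists>s\<ge>t0. X s \<le> c'"
    proof (rule ccontr)
      assume "\<not> (\<exists>s\<ge>t0. X s \<le> c')"
      then have above: "\<And>s. s \<ge> t0 \<Longrightarrow> c' < X s" by force
      have below: "X s \<le> X t0" if "s \<ge> t0" for s
        using barrier[of t0 s "X t0"] that above[of t0] c' init by auto
      have sub: "{c'..X t0} \<subseteq> {a<..<b}" using c' init by auto
      obtain u where u: "u \<in> {c'..X t0}" "\<And>v. v \<in> {c'..X t0} \<Longrightarrow> g v \<le> g u"
        using continuous_attains_sup[of "{c'..X t0}" g] continuous_on_subset[OF cont sub]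
          above[of t0] by fastforce
      have "g u < 0" using u(1) sub neg by auto
      \<comment> \<open>A time by which falling at the rate \<open>- g u\<close> must have brought \<open>X\<close> below \<open>c'\<close>.\<close>
      define T where "T = t0 + 1 + (X t0 - c') / (- g u)"
      have T: "T > t0"
        using \<open>g u < 0\<close> above[of t0] by (auto simp: T_def intro!: add_pos_nonneg divide_nonneg_neg divide_nonpos_neg)
      obtain \<xi> where \<xi>: "t0 < \<xi>" "\<xi> < T" "X T - X t0 = (T - t0) * X' \<xi>"
        by (rule mean_value_half_line[OF deriv order.refl T])
      have "X' \<xi> \<le> g u"
        using le[of \<xi>] u(2)[of "X \<xi>"] above[of \<xi>] below[of \<xi>] \<xi> by auto
      then have "X T - X t0 \<le> (T - t0) * g u"
        using \<xi> T by (simp add: mult_left_mono)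
      also have "\<dots> = g u - (X t0 - c')"
        using \<open>g u < 0\<close> by (simp add: T_def field_simps)
      finally show False using above[of T] T \<open>g u < 0\<close> by simp
    qed
    then obtain s where s: "s \<ge> t0" "X s \<le> c'" by blast
    have "X t \<le> c" if "t \<ge> s" for t
      using barrier[of s t c'] s c' that by auto
    then show ?thesis by (auto simp: eventually_at_top_linorder)
  qed
qed

section \<open>Consequences of unique solvability for autonomous scalar equations\<close>

lemma restart_autonomous:
  assumes "solves_ode (\<lambda>t. g) t0 S Y" "s \<ge> t0"
  shows "solves_ode (\<lambda>t. g) t0 S (\<lambda>t. Y (s + (t - t0)))"
  unfolding solves_ode_def
proof (intro allI impI conjI)
  fix t assume "t \<ge> t0"
  then show "Y (s + (t - t0)) \<in> S"
    using assms by (simp add: solves_ode_def)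
  have "((\<lambda>t. s + (t - t0)) has_vector_derivative 1) (at t within {t0..})"
    by (auto intro!: derivative_eq_intros)
  moreover have "(Y has_vector_derivative g (Y (s + (t - t0))))
      (at (s + (t - t0)) within (\<lambda>t. s + (t - t0)) ` {t0..})"
    by (rule has_vector_derivative_within_subset[where S="{t0..}"])
       (use assms \<open>t \<ge> t0\<close> in \<open>auto simp: solves_ode_def\<close>)
  ultimately show "((\<lambda>t. Y (s + (t - t0))) has_vector_derivative g (Y (s + (t - t0)))) (at t within {t0..})"
    using vector_diff_chain_within[of "\<lambda>t. s + (t - t0)" 1 t "{t0..}" Y] by (simp add: o_def)
qed

text \<open>Uniqueness is only assumed for initial values at \<open>t0\<close>. Since the equation is autonomous, it
transfers to later times by translating the solutions back to \<open>t0\<close>.\<close>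

lemma solutions_coincide:
  assumes "uniquely_solvable (\<lambda>t. g) t0 S"
    and Y: "solves_ode (\<lambda>t. g) t0 S Y" and Z: "solves_ode (\<lambda>t. g) t0 S Z"
    and "t0 \<le> s" "s \<le> t" "Y s = Z s"
  shows "Y t = Z t"
proof -
  let ?Y = "\<lambda>t. Y (s + (t - t0))" and ?Z = "\<lambda>t. Z (s + (t - t0))"
  have "solves_ode (\<lambda>t. g) t0 S ?Y" "solves_ode (\<lambda>t. g) t0 S ?Z"
    using assms restart_autonomous by blast+
  moreover have "Y s \<in> S" using Y \<open>t0 \<le> s\<close> by (simp add: solves_ode_def)
  ultimately have "\<forall>u\<ge>t0. ?Y u = ?Z u"
    using assms(1) \<open>Y s = Z s\<close> unfolding uniquely_solvable_def
    by (smt (verit) add.right_neutral diff_self)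
  from this[rule_format, of "t0 + (t - s)"] show ?thesis using \<open>s \<le> t\<close> by simp
qed

lemma solves_ode_real_derivative:
  fixes Y :: "real \<Rightarrow> real"
  assumes "solves_ode h t0 S Y" "t \<ge> t0"
  shows "(Y has_real_derivative h t (Y t)) (at t within {t0..})"
  using assms by (simp add: solves_ode_def has_real_derivative_iff_has_vector_derivative)

text \<open>To change their order two solutions would have to meet, and from then on they agree.\<close>

lemma solution_order_preserved:
  fixes Y Z :: "real \<Rightarrow> real"
  assumes uniq: "uniquely_solvable (\<lambda>t. g) t0 S"
    and Y: "solves_ode (\<lambda>t. g) t0 S Y" and Z: "solves_ode (\<lambda>t. g) t0 S Z"
    and "Y t0 \<le> Z t0" "t \<ge> t0"
  shows "Y t \<le> Z t"
proof (rule ccontr)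
  assume "\<not> Y t \<le> Z t"
  have "continuous_on {t0..t} (\<lambda>u. Y u - Z u)"
    by (intro continuous_on_diff; rule continuous_on_subset[OF continuous_on_half_line])
       (use Y Z solves_ode_real_derivative in \<open>auto, blast+\<close>)
  then obtain s where "t0 \<le> s" "s \<le> t" "Y s - Z s = 0"
    using IVT'[of "\<lambda>u. Y u - Z u" t0 0 t] assms \<open>\<not> Y t \<le> Z t\<close> by auto
  then have "Y t = Z t" using solutions_coincide[OF uniq Y Z] by auto
  then show False using \<open>\<not> Y t \<le> Z t\<close> by simp
qed

section \<open>Comparison with an equilibrium\<close>

lemma integral_has_derivative_half_line:
  fixes h :: "real \<Rightarrow> real"
  assumes "continuous_on {t0..} h" "t \<ge> t0"
  shows "((\<lambda>t. integral {t0..t} h) has_real_derivative h t) (at t within {t0..})"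
proof -
  have "((\<lambda>t. integral {t0..t} h) has_vector_derivative h t) (at t within {t0..t+1})"
    by (rule integral_has_vector_derivative)
       (use assms in \<open>auto intro: continuous_on_subset\<close>)
  moreover have "at t within {t0..t+1} = at t within {t0..}"
    by (rule at_within_nhd[where S="{..<t+1}"]) auto
  ultimately show ?thesis
    by (simp add: has_real_derivative_iff_has_vector_derivative)
qed

text \<open>Continuity of the flow at the equilibrium \<open>d\<close> from above, obtained from uniqueness and not from a
Lipschitz condition. The solutions are ordered, hence decrease in \<open>n\<close> to a limit \<open>Z \<ge> d\<close>. Dominated
convergence in the integral equations shows that \<open>Z\<close> is itself a solution starting at \<open>d\<close>, so it is
the constant one.\<close>

lemma solutions_decrease_to_equilibrium:
  fixes g :: "real \<Rightarrow> real"
  assumes uniq: "uniquely_solvable (\<lambda>t. g) t0 {0..}"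
    and cont: "continuous_on {0..} g" and d: "0 \<le> d" "g d = 0"
    and Y: "\<And>n. solves_ode (\<lambda>t. g) t0 {0..} (Y n)"
    and init: "\<And>n. Y n t0 = d + 1 / (real n + 1)"
    and "t \<ge> t0"
  shows "(\<lambda>n. Y n t) \<longlonglongrightarrow> d"
proof -
  have const: "solves_ode (\<lambda>t. g) t0 {0..} (\<lambda>_. d)"
    using d by (simp add: solves_ode_def)
  have lower: "d \<le> Y n t" if "t \<ge> t0" for n t
    using solution_order_preserved[OF uniq const Y[of n] _ that] init[of n] by simp
  have mono: "Y (Suc n) t \<le> Y n t" if "t \<ge> t0" for n t
    using solution_order_preserved[OF uniq Y[of "Suc n"] Y[of n] _ that] init
    by (simp add: frac_le)
  then have dec: "decseq (\<lambda>n. Y n t)" if "t \<ge> t0" for t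
    using that by (intro decseq_SucI)
  define Z where "Z t = lim (\<lambda>n. Y n t)" for t
  have lim: "(\<lambda>n. Y n t) \<longlonglongrightarrow> Z t" if "t \<ge> t0" for t
    using decseq_convergent[OF dec[OF that], of d] lower[OF that]
    unfolding Z_def by (metis limI)
  have Zge: "d \<le> Z t" if "t \<ge> t0" for t
    by (rule LIMSEQ_le_const[OF lim[OF that]]) (use lower[OF that] in blast)
  have contY: "continuous_on {t0..} (Y n)" for n
    by (rule continuous_on_half_line[OF solves_ode_real_derivative[OF Y]])
  have contgY: "continuous_on {t0..} (\<lambda>s. g (Y n s))" for n
    by (rule continuous_on_compose2[OF cont contY])
       (use lower d in \<open>force intro: order_trans\<close>)
  have eqY: "integral {t0..T} (\<lambda>s. g (Y n s)) = Y n T - Y n t0" if "T \<ge> t0" for n T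
  proof -
    have "(Y n has_vector_derivative g (Y n s)) (at s within {t0..T})" if "s \<in> {t0..T}" for s
      by (rule has_vector_derivative_within_subset[where S="{t0..}"])
         (use Y[of n] that in \<open>auto simp: solves_ode_def\<close>)
    then show ?thesis
      using fundamental_theorem_of_calculus[OF that, of "Y n" "\<lambda>s. g (Y n s)"]
      by (intro integral_unique) simp
  qed
  have limit_eq: "(\<lambda>s. g (Z s)) integrable_on {t0..T}"
    "integral {t0..T} (\<lambda>s. g (Z s)) = Z T - d" if "T \<ge> t0" for T
  proof -
    have "compact (Y 0 ` {t0..T})"
      by (rule compact_continuous_image[OF continuous_on_subset[OF contY]]) auto
    then obtain B where B: "\<And>s. s \<in> {t0..T} \<Longrightarrow> Y 0 s \<le> B"
      using bounded_imp_bdd_above[OF compact_imp_bounded, of "Y 0 ` {t0..T}"]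
      unfolding bdd_above_def by (meson imageI)
    have "compact (g ` {d..B})"
      by (rule compact_continuous_image[OF continuous_on_subset[OF cont]]) (use d in auto)
    then obtain M where M: "\<And>u. u \<in> {d..B} \<Longrightarrow> norm (g u) \<le> M"
      using compact_imp_bounded[of "g ` {d..B}"] unfolding bounded_iff by (meson imageI)
    have upper: "Y n s \<le> B" if "s \<in> {t0..T}" for n s
      using decseqD[OF dec[of s], of 0 n] B[OF that] that by simp
    have "(\<lambda>s. g (Y n s)) integrable_on {t0..T}" for n
      by (rule integrable_continuous_real[OF continuous_on_subset[OF contgY]]) auto
    moreover have "(\<lambda>n. g (Y n s)) \<longlonglongrightarrow> g (Z s)" if "s \<in> {t0..T}" for s
    proof -
      have "s \<ge> t0" using that by simp
      have "0 \<le> Y n s" for n using lower[OF \<open>s \<ge> t0\<close>, of n] d by linarith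
      moreover have "0 \<le> Z s" using Zge[OF \<open>s \<ge> t0\<close>] d by linarith
      ultimately show ?thesis
        by (intro continuous_on_tendsto_compose[OF cont lim[OF \<open>s \<ge> t0\<close>]]) auto
    qed
    moreover have "norm (g (Y n s)) \<le> M" if "s \<in> {t0..T}" for n s
      using M upper[OF that] lower[of s n] that by simp
    ultimately have dc: "(\<lambda>s. g (Z s)) integrable_on {t0..T}"
      "(\<lambda>n. integral {t0..T} (\<lambda>s. g (Y n s))) \<longlonglongrightarrow> integral {t0..T} (\<lambda>s. g (Z s))"
      using dominated_convergence[where f="\<lambda>n s. g (Y n s)" and S="{t0..T}" and h="\<lambda>_. M"
          and g="\<lambda>s. g (Z s)"] by auto
    show "(\<lambda>s. g (Z s)) integrable_on {t0..T}" by (rule dc)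
    have "(\<lambda>n. 1 / (real n + 1)) \<longlonglongrightarrow> 0"
      using LIMSEQ_inverse_real_of_nat by (simp add: inverse_eq_divide add.commute)
    then have "(\<lambda>n. d + 1 / (real n + 1)) \<longlonglongrightarrow> d + 0"
      by (intro tendsto_intros)
    then have "(\<lambda>n. integral {t0..T} (\<lambda>s. g (Y n s))) \<longlonglongrightarrow> Z T - (d + 0)"
      unfolding eqY[OF that] init by (intro tendsto_diff lim that)
    then show "integral {t0..T} (\<lambda>s. g (Z s)) = Z T - d"
      using LIMSEQ_unique[OF dc(2)] by simp
  qed
  have Zeq: "Z s = d + integral {t0..s} (\<lambda>s. g (Z s))" if "s \<ge> t0" for s
    using limit_eq(2)[OF that] by simp
  have contZ: "continuous_on {t0..} Z"
  proof (rule continuous_on_eq_continuous_within[THEN iffD2, rule_format])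
    fix s assume "s \<in> {t0..}"
    have "continuous_on {t0..s+1} (\<lambda>s. d + integral {t0..s} (\<lambda>s. g (Z s)))"
      using \<open>s \<in> {t0..}\<close>
      by (intro continuous_intros indefinite_integral_continuous_1 limit_eq) auto
    then have "continuous_on {t0..s+1} Z"
      by (rule continuous_on_eq) (simp add: Zeq[symmetric])
    then have "continuous (at s within {t0..s+1}) Z"
      using \<open>s \<in> {t0..}\<close> by (simp add: continuous_on_eq_continuous_within)
    moreover have "at s within {t0..s+1} = at s within {t0..}"
      by (rule at_within_nhd[where S="{..<s+1}"]) auto
    ultimately show "continuous (at s within {t0..}) Z" by simp
  qed
  have "continuous_on {t0..} (\<lambda>s. g (Z s))"
    by (rule continuous_on_compose2[OF cont contZ])
       (use Zge d in \<open>force intro: order_trans\<close>)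
  then have "((\<lambda>s. d + integral {t0..s} (\<lambda>s. g (Z s))) has_real_derivative g (Z s)) (at s within {t0..})"
    if "s \<ge> t0" for s
    using integral_has_derivative_half_line[OF _ that] by (auto intro!: derivative_eq_intros)
  then have "(Z has_vector_derivative g (Z s)) (at s within {t0..})" if "s \<ge> t0" for s
    by (intro has_vector_derivative_transform[OF _ Zeq])
       (use that in \<open>auto simp: has_real_derivative_iff_has_vector_derivative\<close>)
  then have "solves_ode (\<lambda>t. g) t0 {0..} Z"
    using Zge d by (auto simp: solves_ode_def intro: order_trans)
  moreover have "Z t0 = d"
    using Zeq[of t0] by simp
  ultimately have "Z t = d"
    using solutions_coincide[OF uniq _ const order.refl \<open>t \<ge> t0\<close>] by simp
  then show ?thesis using lim[OF \<open>t \<ge> t0\<close>] by simp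
qed

text \<open>If \<open>g < 0\<close> above \<open>d\<close>, then \<open>X\<close> cannot climb above \<open>d\<close>. The case \<open>g > 0\<close> above \<open>d\<close> is the delicate
one: for \<open>g\<close> merely continuous the inequality \<open>X' \<le> g X\<close> alone would allow \<open>X\<close> to leave \<open>d\<close>
upwards, as it does for \<open>g u = sqrt (u - d)\<close>. What forbids it is that \<open>d\<close> is the only solution
starting at \<open>d\<close>. The solutions \<open>Y n\<close> starting just above \<open>d\<close> are run at double speed. They then
satisfy \<open>Y' = 2 g Y > g Y\<close>, so at a first contact \<open>X\<close> would be strictly slower, which keeps \<open>X\<close>
below every \<open>Y n\<close>. Letting \<open>n\<close> grow gives \<open>X \<le> d\<close>, since the time change does not affect the
pointwise limit \<open>d\<close>.\<close>

lemma never_above_equilibrium: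
  fixes g X :: "real \<Rightarrow> real"
  assumes uniq: "uniquely_solvable (\<lambda>t. g) t0 {0..}"
    and cont: "continuous_on {0..} g" and d: "0 \<le> d" "g d = 0"
    and sign: "(\<forall>u>d. g u < 0) \<or> (\<forall>u>d. g u > 0)"
    and deriv: "\<And>t. t \<ge> t0 \<Longrightarrow> (X has_real_derivative X' t) (at t within {t0..})"
    and le: "\<And>t. t \<ge> t0 \<Longrightarrow> X' t \<le> g (X t)"
    and "X t0 \<le> d" "t \<ge> t0"
  shows "X t \<le> d"
  using sign
proof
  assume neg: "\<forall>u>d. g u < 0"
  show "X t \<le> d"
  proof (rule ccontr)
    assume "\<not> X t \<le> d"
    then have "d < X t" by simp
    obtain \<xi> where "t0 < \<xi>" "d < X \<xi>" "X' \<xi> > 0"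
      by (rule up_crossing[OF deriv order.refl \<open>t \<ge> t0\<close> \<open>X t0 \<le> d\<close> \<open>d < X t\<close> order.refl])
    then show False using le[of \<xi>] neg by force
  qed
next
  assume pos: "\<forall>u>d. g u > 0"
  have "\<exists>Y. solves_ode (\<lambda>t. g) t0 {0..} Y \<and> Y t0 = d + 1 / (real n + 1)" for n
    using uniq d unfolding uniquely_solvable_def by (metis atLeast_iff add_nonneg_nonneg
        divide_nonneg_nonneg of_nat_0_le_iff zero_le_one)
  then obtain Y where Y: "\<And>n. solves_ode (\<lambda>t. g) t0 {0..} (Y n)"
    and init: "\<And>n. Y n t0 = d + 1 / (real n + 1)"
    by metis
  have above: "d < Y n s" if s: "s \<ge> t0" for n s
  proof (rule ccontr)
    assume "\<not> d < Y n s"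
    have "((\<lambda>s. - Y n s) has_real_derivative - g (Y n s)) (at s within {t0..})" if "s \<ge> t0" for s
      using solves_ode_real_derivative[OF Y that] by (auto intro!: derivative_eq_intros)
    moreover have "- Y n t0 < - d" by (simp add: init add_pos_nonneg)
    moreover have "- d \<le> - Y n s" using \<open>\<not> d < Y n s\<close> by simp
    ultimately obtain \<xi> where "t0 < \<xi>" "- Y n t0 < - Y n \<xi>" "- Y n \<xi> < - d" "- g (Y n \<xi>) > 0"
      using up_crossing[where X="\<lambda>t. - Y n t" and X'="\<lambda>t. - g (Y n t)", OF _ order.refl s order.refl]
      by metis
    then show False using pos by (smt (verit))
  qed
  have below: "X s \<le> Y n (t0 + 2 * (s - t0))" if "s \<ge> t0" for n s
  proof (rule ccontr)
    define V where "V s = X s - Y n (t0 + 2 * (s - t0))" for s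
    define V' where "V' s = X' s - 2 * g (Y n (t0 + 2 * (s - t0)))" for s
    have deriv_scaled: "((\<lambda>s. Y n (t0 + 2 * (s - t0))) has_real_derivative
        2 * g (Y n (t0 + 2 * (s - t0)))) (at s within {t0..})" if "s \<ge> t0" for s
    proof -
      have "((\<lambda>s. t0 + 2 * (s - t0)) has_vector_derivative 2) (at s within {t0..})"
        by (auto intro!: derivative_eq_intros)
      moreover have "(Y n has_vector_derivative g (Y n (t0 + 2 * (s - t0))))
          (at (t0 + 2 * (s - t0)) within (\<lambda>s. t0 + 2 * (s - t0)) ` {t0..})"
        by (rule has_vector_derivative_within_subset[where S="{t0..}"])
           (use Y[of n] that in \<open>auto simp: solves_ode_def\<close>)
      ultimately show ?thesis
        using vector_diff_chain_within[of "\<lambda>s. t0 + 2 * (s - t0)" 2 s "{t0..}" "Y n"]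
        by (simp add: o_def has_real_derivative_iff_has_vector_derivative)
    qed
    have derivV: "(V has_real_derivative V' s) (at s within {t0..})" if "s \<ge> t0" for s
      unfolding V_def V'_def using deriv[OF that] deriv_scaled[OF that] by (rule DERIV_diff)
    assume "\<not> X s \<le> Y n (t0 + 2 * (s - t0))"
    then have "V s > 0" by (simp add: V_def)
    have "V t0 < 0" using \<open>X t0 \<le> d\<close> above[of t0 n] by (simp add: V_def)
    have contV: "continuous_on {t0..s} V"
      by (rule continuous_on_subset[OF continuous_on_half_line[OF derivV]]) auto
    obtain \<tau> where \<tau>: "t0 < \<tau>" "V \<tau> = 0" "\<And>u. t0 \<le> u \<Longrightarrow> u < \<tau> \<Longrightarrow> V u < 0"
    proof -
      have "closed {u \<in> {t0..s}. 0 \<le> V u}"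
        by (intro continuous_on_closed_Collect_le contV continuous_intros)
      then have "compact ({t0..s} \<inter> {u \<in> {t0..s}. 0 \<le> V u})"
        by (intro compact_Int_closed) auto
      then have "compact {u \<in> {t0..s}. 0 \<le> V u}"
        by (simp add: Int_def conj_ac)
      moreover have "{u \<in> {t0..s}. 0 \<le> V u} \<noteq> {}"
        using \<open>V s > 0\<close> \<open>s \<ge> t0\<close> by force
      ultimately obtain \<tau> where \<tau>: "\<tau> \<in> {t0..s}" "0 \<le> V \<tau>"
        and first: "\<And>u. u \<in> {t0..s} \<Longrightarrow> 0 \<le> V u \<Longrightarrow> \<tau> \<le> u"
        using compact_attains_inf[of "{u \<in> {t0..s}. 0 \<le> V u}"] by blast
      have "continuous_on {t0..\<tau>} V"
        by (rule continuous_on_subset[OF contV]) (use \<tau> in auto)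
      then obtain u where "t0 \<le> u" "u \<le> \<tau>" "V u = 0"
        using IVT'[of V t0 0 \<tau>] \<open>V t0 < 0\<close> \<tau> by auto
      then have "V \<tau> = 0" using first[of u] \<tau> by auto
      then show thesis
        using that[of \<tau>] \<tau> first \<open>V t0 < 0\<close> by force
    qed
    \<comment> \<open>At the first zero of the gap its derivative is at most \<open>g Y - 2 g Y < 0\<close>, whereas the
      gap came from negative values.\<close>
    have "g (Y n (t0 + 2 * (\<tau> - t0))) > 0"
      using pos above[of "t0 + 2 * (\<tau> - t0)" n] \<tau> by auto
    then have "V' \<tau> < 0"
      using le[of \<tau>] \<tau> by (simp add: V'_def V_def)
    then obtain e where e: "e > 0" "\<And>h. h > 0 \<Longrightarrow> \<tau> - h \<in> {t0..} \<Longrightarrow> h < e \<Longrightarrow> V \<tau> < V (\<tau> - h)"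
      using has_real_derivative_neg_dec_left[OF derivV[of \<tau>]] \<tau> by auto
    define h where "h = min (e / 2) (\<tau> - t0)"
    have "0 < h" "h < e" "t0 \<le> \<tau> - h"
      using e(1) \<tau>(1) by (auto simp: h_def min_def)
    then show False
      using e(2)[of h] \<tau>(2) \<tau>(3)[of "\<tau> - h"] by simp
  qed
  have "(\<lambda>n. Y n (t0 + 2 * (t - t0))) \<longlonglongrightarrow> d"
    by (rule solutions_decrease_to_equilibrium[OF uniq cont d Y init]) (use \<open>t \<ge> t0\<close> in auto)
  then show "X t \<le> d"
    by (rule LIMSEQ_le_const) (use below[OF \<open>t \<ge> t0\<close>] in blast)
qed

section \<open>From stability of the equilibrium to the sign of the right-hand side\<close>

lemma continuous_nonzero_sign:
  fixes g :: "real \<Rightarrow> real"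
  assumes "is_interval S" "continuous_on S g" "\<And>u. u \<in> S \<Longrightarrow> g u \<noteq> 0"
  shows "(\<forall>u\<in>S. g u < 0) \<or> (\<forall>u\<in>S. g u > 0)"
proof (rule ccontr)
  assume "\<not> ?thesis"
  then obtain u v where "u \<in> S" "v \<in> S" "g u > 0" "g v < 0"
    using assms(3) by (metis linorder_neqE)
  moreover have "is_interval (g ` S)"
    using assms by (simp add: is_interval_connected_1 connected_continuous_image)
  ultimately have "0 \<in> g ` S"
    unfolding is_interval_1 by (meson imageI less_imp_le)
  then show False using assms(3) by force
qed

text \<open>If \<open>g\<close> were positive above \<open>d\<close>, a solution starting slightly above \<open>d\<close> would leave every bounded
neighbourhood; this is the decay lemma applied to \<open>-Y\<close>.\<close>

lemma stable_imp_negative_above: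
  fixes g :: "real \<Rightarrow> real"
  assumes uniq: "uniquely_solvable (\<lambda>t. g) t0 {0..}"
    and cont: "continuous_on {0..} g" and d: "0 \<le> d"
    and sign: "(\<forall>u\<in>{d<..}. g u < 0) \<or> (\<forall>u\<in>{d<..}. g u > 0)"
    and stable: "stable_solution (\<lambda>t. g) t0 {0..} {0..} (\<lambda>_. d)"
    and "u > d"
  shows "g u < 0"
proof (rule ccontr)
  assume "\<not> g u < 0"
  with sign \<open>u > d\<close> have pos: "\<And>u. u > d \<Longrightarrow> g u > 0" by auto
  \<comment> \<open>Stability with tolerance \<open>1\<close> keeps \<open>Y\<close> below \<open>d + 1\<close>, whereas the decay of \<open>- Y\<close> in the
    strip between \<open>- (d + 2)\<close> and \<open>- d\<close> brings \<open>Y\<close> to at least \<open>d + 1\<close>.\<close>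
  obtain \<delta> where \<delta>: "\<delta> > 0" "\<And>y t. solves_ode (\<lambda>t. g) t0 {0..} y \<Longrightarrow> y t0 \<ge> 0 \<Longrightarrow>
      dist (y t0) d < \<delta> \<Longrightarrow> t \<ge> t0 \<Longrightarrow> dist (y t) d < 1"
    using stable unfolding stable_solution_def by (metis atLeast_iff zero_less_one)
  define y0 where "y0 = d + \<delta> / 2"
  have "y0 \<in> {0..}" using d \<delta> by (simp add: y0_def)
  then obtain Y where Y: "solves_ode (\<lambda>t. g) t0 {0..} Y" "Y t0 = y0"
    using uniq unfolding uniquely_solvable_def by meson
  have near: "dist (Y t) d < 1" if "t \<ge> t0" for t
    by (rule \<delta>(2)[OF Y(1) _ _ that]) (use Y d \<delta>(1) in \<open>auto simp: y0_def dist_real_def\<close>)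
  have "((\<lambda>t. - Y t) has_real_derivative - g (Y t)) (at t within {t0..})" if "t \<ge> t0" for t
    using solves_ode_real_derivative[OF Y(1) that] by (auto intro!: derivative_eq_intros)
  moreover have "continuous_on {- (d + 2)<..<- d} (\<lambda>u. - g (- u))"
    by (intro continuous_intros continuous_on_compose2[OF cont]) (use d in auto)
  moreover have "- Y t0 < - d" using Y(2) \<delta>(1) by (simp add: y0_def)
  moreover have "- g (- v) < 0" if "v < - d" for v using pos[of "- v"] that by simp
  ultimately have "\<forall>\<^sub>F t in at_top. - Y t \<le> - (d + 1)"
    by - (rule eventually_le_level[where a="- (d + 2)" and b="- d" and g="\<lambda>u. - g (- u)"],
      assumption, simp_all)
  then obtain N where "\<And>t. t \<ge> N \<Longrightarrow> - Y t \<le> - (d + 1)"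
    by (auto simp: eventually_at_top_linorder)
  from this[of "max N t0"] near[of "max N t0"] show False
    by (auto simp: dist_real_def)
qed

text \<open>If \<open>g\<close> were positive between \<open>0\<close> and \<open>d\<close>, a solution starting in that interval could neither
decrease nor, by order preservation, exceed \<open>d\<close>. It would stay at least as close to \<open>d\<close> as it
started, so \<open>d\<close> would be stable from below.\<close>

lemma unstable_imp_negative_below:
  fixes g :: "real \<Rightarrow> real"
  assumes uniq: "uniquely_solvable (\<lambda>t. g) t0 {0..}"
    and d: "0 < d" "g d = 0"
    and sign: "(\<forall>u\<in>{0<..<d}. g u < 0) \<or> (\<forall>u\<in>{0<..<d}. g u > 0)"
    and unstable: "\<not> stable_solution (\<lambda>t. g) t0 {0..} {0..d} (\<lambda>_. d)"
    and u: "0 < u" "u < d"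
  shows "g u < 0"
proof (rule ccontr)
  assume "\<not> g u < 0"
  with sign u have pos: "\<And>u. 0 < u \<Longrightarrow> u < d \<Longrightarrow> g u > 0" by auto
  have const: "solves_ode (\<lambda>t. g) t0 {0..} (\<lambda>_. d)"
    using d by (simp add: solves_ode_def)
  have "dist (y t) d < \<epsilon>" if "\<epsilon> > 0" and y: "solves_ode (\<lambda>t. g) t0 {0..} y"
    "y t0 \<le> d" "dist (y t0) d < min \<epsilon> d" and "t \<ge> t0" for \<epsilon> y t
  proof -
    have le: "y t \<le> d" if "t \<ge> t0" for t
      by (rule solution_order_preserved[OF uniq y(1) const y(2) that])
    have "y t0 \<le> y t"
    proof (rule ccontr)
      assume "\<not> y t0 \<le> y t"
      have "((\<lambda>t. - y t) has_real_derivative - g (y t)) (at t within {t0..})" if "t \<ge> t0" for t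
        using solves_ode_real_derivative[OF y(1) that] by (auto intro!: derivative_eq_intros)
      \<comment> \<open>The cap \<open>0\<close> keeps the crossing value of \<open>y\<close> positive, where the sign of \<open>g\<close> is known.
        The room for it comes from the distance to \<open>d\<close> being less than \<open>d\<close>.\<close>
      moreover have "- y t0 < min (- y t) 0"
        using y \<open>\<not> y t0 \<le> y t\<close> d by (auto simp: dist_real_def)
      ultimately obtain \<xi> where \<xi>: "t0 < \<xi>" "- y t0 < - y \<xi>" "- y \<xi> < min (- y t) 0"
        "- g (y \<xi>) > 0"
        using up_crossing[where X="\<lambda>t. - y t" and X'="\<lambda>t. - g (y t)", OF _ order.refl \<open>t \<ge> t0\<close> order.refl]
        by (metis min.cobounded1)
      then show False using pos[of "y \<xi>"] y(2) by auto
    qed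
    then show ?thesis
      using le[OF \<open>t \<ge> t0\<close>] y by (auto simp: dist_real_def)
  qed
  then have "\<exists>\<delta>>0. \<forall>y. solves_ode (\<lambda>t. g) t0 {0..} y \<and> y t0 \<in> {0..d} \<and> dist (y t0) d < \<delta>
      \<longrightarrow> (\<forall>t\<ge>t0. dist (y t) d < \<epsilon>)" if "\<epsilon> > 0" for \<epsilon>
    using that d(1) by (intro exI[of _ "min \<epsilon> d"]) auto
  then have "stable_solution (\<lambda>t. g) t0 {0..} {0..d} (\<lambda>_. d)"
    unfolding stable_solution_def by blast
  then show False using unstable by contradiction
qed

section \<open>The scalar majorant of a solution of the system\<close>

lemma spectral_norm_nonneg: "0 \<le> spectral_norm M"
  by (simp add: spectral_norm_def onorm_pos_le matrix_vector_mul_bounded_linear)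

lemma norm_matrix_vector_le: "norm (M *v v) \<le> spectral_norm M * norm v"
  unfolding spectral_norm_def by (rule onorm) (rule matrix_vector_mul_bounded_linear)

lemma spectral_norm_pos:
  fixes M :: "real^'n^'n"
  assumes "invertible M"
  shows "0 < spectral_norm M"
proof -
  obtain M' where "M' ** M = mat 1" using assms by (auto simp: invertible_def)
  then have "M *v v \<noteq> 0" if "v \<noteq> 0" for v
    using that by (metis matrix_vector_mul_assoc matrix_vector_mul_lid matrix_vector_mult_0_right)
  moreover have "axis undefined 1 \<noteq> (0 :: real^'n)" by (simp add: axis_eq_0_iff)
  ultimately show ?thesis
    unfolding spectral_norm_def
    using onorm_pos_lt[OF matrix_vector_mul_bounded_linear[of M]] by blast
qed

lemma matrix_inv_cancel:
  fixes M :: "real^'n^'n"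
  assumes "invertible M"
  shows "M *v (matrix_inv M *v v) = v" "matrix_inv M *v (M *v v) = v"
proof -
  have "M ** matrix_inv M = mat 1 \<and> matrix_inv M ** M = mat 1"
    using assms unfolding invertible_def matrix_inv_def by (rule someI_ex)
  then show "M *v (matrix_inv M *v v) = v" "matrix_inv M *v (M *v v) = v"
    by (simp_all add: matrix_vector_mul_assoc)
qed

lemma has_vector_derivative_matrix_vector:
  fixes W :: "real \<Rightarrow> real^'n^'m" and v :: "real^'n"
  assumes "(W has_vector_derivative W') F"
  shows "((\<lambda>s. W s *v v) has_vector_derivative W' *v v) F"
proof -
  have "linear (\<lambda>M :: real^'n^'m. M *v v)"
    by (intro linearI) (simp_all add: matrix_vector_mult_add_rdistrib scaleR_matrix_vector_assoc)
  then show ?thesis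
    using assms by (rule bounded_linear.has_vector_derivative[OF linear_conv_bounded_linear[THEN iffD1]])
qed

text \<open>Inverse matrices depend continuously on the matrix, here in the form needed for difference
quotients. With \<open>u\<close> the inverse image of the limit,
\<open>W\<^sup>-\<^sup>1 q - u = W\<^sup>-\<^sup>1 (q - W u)\<close>, and the right-hand side is small as soon as the norms of the inverses
converge.\<close>

lemma inverse_matrix_tendsto:
  fixes W :: "real \<Rightarrow> real^'n^'n"
  assumes inv: "\<forall>\<^sub>F s in F. invertible (W s)" "invertible M"
    and lim: "((\<lambda>s. W s *v (matrix_inv M *v v)) \<longlongrightarrow> v) F"
    and bound: "((\<lambda>s. spectral_norm (matrix_inv (W s))) \<longlongrightarrow> B) F"
    and q: "(q \<longlongrightarrow> v) F"
  shows "((\<lambda>s. matrix_inv (W s) *v q s) \<longlongrightarrow> matrix_inv M *v v) F"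
proof -
  let ?u = "matrix_inv M *v v"
  have "((\<lambda>s. spectral_norm (matrix_inv (W s)) * norm (q s - W s *v ?u)) \<longlongrightarrow> B * norm (v - v)) F"
    by (intro tendsto_intros bound q lim)
  then have small: "((\<lambda>s. spectral_norm (matrix_inv (W s)) * norm (q s - W s *v ?u)) \<longlongrightarrow> 0) F"
    by simp
  have "\<forall>\<^sub>F s in F. norm (matrix_inv (W s) *v q s - ?u)
      \<le> spectral_norm (matrix_inv (W s)) * norm (q s - W s *v ?u)"
    using inv(1)
  proof eventually_elim
    case (elim s)
    have "matrix_inv (W s) *v q s - ?u = matrix_inv (W s) *v (q s - W s *v ?u)"
      by (simp add: matrix_vector_mult_diff_distrib matrix_inv_cancel elim)
    then show ?case using norm_matrix_vector_le by metis
  qed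
  then have "((\<lambda>s. matrix_inv (W s) *v q s - ?u) \<longlongrightarrow> 0) F"
    by (rule Lim_null_comparison) (rule small)
  then show ?thesis by (rule LIM_zero_cancel)
qed

lemma has_vector_derivative_iff_quotient:
  "(f has_vector_derivative f') (at t within S) \<longleftrightarrow>
    ((\<lambda>s. (1 / (s - t)) *\<^sub>R (f s - f t)) \<longlongrightarrow> f') (at t within S)"
proof -
  have "norm ((f s - f t) - (s - t) *\<^sub>R f') / norm (s - t)
      = norm ((1 / (s - t)) *\<^sub>R (f s - f t) - f')" if "s \<noteq> t" for s
  proof -
    have "(1 / (s - t)) *\<^sub>R (f s - f t) - f' = (1 / (s - t)) *\<^sub>R ((f s - f t) - (s - t) *\<^sub>R f')"
      using that by (simp add: scaleR_diff_right)
    then show ?thesis by simp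
  qed
  then have "((\<lambda>s. norm ((f s - f t) - (s - t) *\<^sub>R f') / norm (s - t)) \<longlongrightarrow> 0) (at t within S) \<longleftrightarrow>
      ((\<lambda>s. norm ((1 / (s - t)) *\<^sub>R (f s - f t) - f')) \<longlongrightarrow> 0) (at t within S)"
    by (intro tendsto_cong) (auto simp: eventually_at_filter)
  then show ?thesis
    unfolding has_vector_derivative_def has_derivative_iff_norm
    by (simp only: bounded_linear_scaleR_left tendsto_norm_zero_iff LIM_zero_iff simp_thms)
qed

text \<open>The classical change of variables \<open>y = W c\<close> removes the linear part of the equation. No derivative
of the inverse matrix is computed: with \<open>u = c t\<close> fixed, \<open>c s - u = W s\<^sup>-\<^sup>1 (y s - W s u)\<close>, and
\<open>y s - W s u\<close> vanishes at \<open>s = t\<close> and has derivative \<open>f t (y t)\<close> there.\<close>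

lemma variation_of_constants_derivative:
  fixes W :: "real \<Rightarrow> real^'n^'n"
  assumes W: "fundamental_matrix A t0 W"
    and inv_cont: "continuous_on {t0..} (\<lambda>s. spectral_norm (matrix_inv (W s)))"
    and y: "solves_ode (\<lambda>t z. A t *v z + f t z) t0 UNIV y"
    and "t \<ge> t0"
  shows "((\<lambda>s. matrix_inv (W s) *v y s) has_vector_derivative matrix_inv (W t) *v f t (y t))
    (at t within {t0..})"
proof -
  let ?F = "at t within {t0..}"
  define u where "u = matrix_inv (W t) *v y t"
  have invW: "invertible (W s)" if "s \<ge> t0" for s
    using W that by (simp add: fundamental_matrix_def)
  have derivW: "(W has_vector_derivative A t ** W t) ?F"
    using W \<open>t \<ge> t0\<close> by (simp add: fundamental_matrix_def)
  have ev: "\<forall>\<^sub>F s in ?F. s \<ge> t0"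
    by (auto simp: eventually_at_filter)
  have "((\<lambda>s. y s - W s *v u) has_vector_derivative (A t *v y t + f t (y t)) - (A t ** W t) *v u) ?F"
    by (intro has_vector_derivative_diff has_vector_derivative_matrix_vector derivW)
       (use y \<open>t \<ge> t0\<close> in \<open>simp add: solves_ode_def\<close>)
  then have "((\<lambda>s. y s - W s *v u) has_vector_derivative f t (y t)) ?F"
    using invW[OF \<open>t \<ge> t0\<close>]
    by (simp add: u_def matrix_vector_mul_assoc[symmetric] matrix_inv_cancel)
  then have quot: "((\<lambda>s. (1 / (s - t)) *\<^sub>R (y s - W s *v u)) \<longlongrightarrow> f t (y t)) ?F"
    using invW[OF \<open>t \<ge> t0\<close>]
    by (simp add: has_vector_derivative_iff_quotient u_def matrix_inv_cancel)
  have "((\<lambda>s. W s *v v) \<longlongrightarrow> W t *v v) ?F" for v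
    using has_vector_derivative_continuous[OF has_vector_derivative_matrix_vector[OF derivW]]
    by (simp add: continuous_within)
  from this[of "matrix_inv (W t) *v f t (y t)"]
  have "((\<lambda>s. W s *v (matrix_inv (W t) *v f t (y t))) \<longlongrightarrow> f t (y t)) ?F"
    using invW[OF \<open>t \<ge> t0\<close>] by (simp add: matrix_inv_cancel)
  then have "((\<lambda>s. matrix_inv (W s) *v ((1 / (s - t)) *\<^sub>R (y s - W s *v u))) \<longlongrightarrow>
      matrix_inv (W t) *v f t (y t)) ?F"
    using inv_cont \<open>t \<ge> t0\<close> eventually_mono[OF ev invW]
    by (intro inverse_matrix_tendsto[OF _ invW _ _ quot]) (auto simp: continuous_on)
  moreover have "\<forall>\<^sub>F s in ?F. matrix_inv (W s) *v ((1 / (s - t)) *\<^sub>R (y s - W s *v u))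
      = (1 / (s - t)) *\<^sub>R (matrix_inv (W s) *v y s - u)"
    using ev
  proof eventually_elim
    case (elim s)
    then show ?case
      by (simp add: matrix_vector_mult_scaleR matrix_vector_mult_diff_distrib matrix_inv_cancel invW)
  qed
  ultimately have "((\<lambda>s. (1 / (s - t)) *\<^sub>R (matrix_inv (W s) *v y s - u)) \<longlongrightarrow>
      matrix_inv (W t) *v f t (y t)) ?F"
    by (rule Lim_transform_eventually)
  then show ?thesis
    by (simp add: has_vector_derivative_iff_quotient u_def)
qed

text \<open>In the coordinates \<open>c = W\<^sup>-\<^sup>1 y\<close> the norm of \<open>c\<close> grows at most as fast as
\<open>N t = |c t0| + \<integral> |W\<^sup>-\<^sup>1| |f|\<close>, so \<open>X = |W| N\<close> dominates the norm of \<open>y\<close>. Unlike the norm of \<open>y\<close>,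
this \<open>X\<close> is differentiable everywhere, and its equation holds whether or not \<open>y\<close> stays in the region
where \<open>f\<close> is controlled.\<close>

lemma scalar_majorant:
  fixes W :: "real \<Rightarrow> real^'n^'n"
  assumes W: "fundamental_matrix A t0 W"
    and p: "\<And>t. t \<ge> t0 \<Longrightarrow>
        ((\<lambda>s. ln (spectral_norm (W s))) has_real_derivative p t) (at t within {t0..})"
    and inv_cont: "continuous_on {t0..} (\<lambda>s. spectral_norm (matrix_inv (W s)))"
    and f_cont: "continuous_on ({t0..} \<times> UNIV) (\<lambda>(t, z). f t z)"
    and y: "solves_ode (\<lambda>t z. A t *v z + f t z) t0 UNIV y"
  obtains X where "X t0 = spectral_norm (W t0) * norm (matrix_inv (W t0) *v y t0)"
    and "\<And>t. t \<ge> t0 \<Longrightarrow> norm (y t) \<le> X t"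
    and "\<And>t. t \<ge> t0 \<Longrightarrow> (X has_real_derivative
        p t * X t + spectral_norm (W t) * spectral_norm (matrix_inv (W t)) * norm (f t (y t)))
        (at t within {t0..})"
proof -
  define c where "c s = matrix_inv (W s) *v y s" for s
  define h where "h s = spectral_norm (matrix_inv (W s)) * norm (f s (y s))" for s
  define N where "N t = norm (c t0) + integral {t0..t} h" for t
  define X where "X t = spectral_norm (W t) * N t" for t
  have invW: "invertible (W s)" if "s \<ge> t0" for s
    using W that by (simp add: fundamental_matrix_def)
  have cont_y: "continuous_on {t0..} y"
    using y unfolding solves_ode_def
    by (auto simp: continuous_on_eq_continuous_within intro: has_vector_derivative_continuous)
  have "continuous_on {t0..} (\<lambda>s. f s (y s))"
    using continuous_on_compose2[OF f_cont, of "{t0..}" "\<lambda>s. (s, y s)"]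
      continuous_on_Pair[OF continuous_on_id cont_y] by auto
  then have cont_h: "continuous_on {t0..} h"
    unfolding h_def by (intro continuous_intros inv_cont)
  have norm_c: "norm (c t) \<le> N t" if "t \<ge> t0" for t
  proof -
    have "(c has_vector_derivative matrix_inv (W s) *v f s (y s)) (at s within {t0..t})"
      if "s \<in> {t0..t}" for s
      unfolding c_def
      by (rule has_vector_derivative_within_subset[OF
            variation_of_constants_derivative[OF W inv_cont y]])
         (use that in auto)
    then have ftc: "((\<lambda>s. matrix_inv (W s) *v f s (y s)) has_integral c t - c t0) {t0..t}"
      by (intro fundamental_theorem_of_calculus that)
    have "norm (integral {t0..t} (\<lambda>s. matrix_inv (W s) *v f s (y s))) \<le> integral {t0..t} h"
    proof (rule integral_norm_bound_integral)
      show "(\<lambda>s. matrix_inv (W s) *v f s (y s)) integrable_on {t0..t}"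
        using ftc by (rule has_integral_integrable)
      show "h integrable_on {t0..t}"
        by (rule integrable_continuous_real[OF continuous_on_subset[OF cont_h]]) auto
      show "norm (matrix_inv (W s) *v f s (y s)) \<le> h s" for s
        unfolding h_def by (rule norm_matrix_vector_le)
    qed
    then have "norm (c t - c t0) \<le> integral {t0..t} h"
      using integral_unique[OF ftc] by simp
    then show ?thesis
      unfolding N_def using norm_triangle_ineq2[of "c t" "c t0"] by linarith
  qed
  show thesis
  proof (rule that)
    show "X t0 = spectral_norm (W t0) * norm (matrix_inv (W t0) *v y t0)"
      by (simp add: X_def N_def c_def)
  next
    fix t assume "t \<ge> t0"
    have "norm (y t) = norm (W t *v c t)"
      using invW[OF \<open>t \<ge> t0\<close>] by (simp add: c_def matrix_inv_cancel)
    also have "\<dots> \<le> spectral_norm (W t) * norm (c t)"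
      by (rule norm_matrix_vector_le)
    also have "\<dots> \<le> X t"
      unfolding X_def by (rule mult_left_mono[OF norm_c[OF \<open>t \<ge> t0\<close>] spectral_norm_nonneg])
    finally show "norm (y t) \<le> X t" .
  next
    fix t assume "t \<ge> t0"
    have pos: "0 < spectral_norm (W s)" if "s \<ge> t0" for s
      by (rule spectral_norm_pos[OF invW[OF that]])
    have "((\<lambda>s. exp (ln (spectral_norm (W s)))) has_real_derivative
        exp (ln (spectral_norm (W t))) * p t) (at t within {t0..})"
      by (rule DERIV_chain2[OF DERIV_exp p[OF \<open>t \<ge> t0\<close>]])
    then have "((\<lambda>s. exp (ln (spectral_norm (W s)))) has_vector_derivative
        spectral_norm (W t) * p t) (at t within {t0..})"
      using pos[OF \<open>t \<ge> t0\<close>] by (simp add: has_real_derivative_iff_has_vector_derivative)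
    then have "((\<lambda>s. spectral_norm (W s)) has_vector_derivative
        spectral_norm (W t) * p t) (at t within {t0..})"
      by (rule has_vector_derivative_transform[rotated 2]) (use \<open>t \<ge> t0\<close> pos in auto)
    then have dW: "((\<lambda>s. spectral_norm (W s)) has_real_derivative
        spectral_norm (W t) * p t) (at t within {t0..})"
      by (simp add: has_real_derivative_iff_has_vector_derivative)
    have dN: "(N has_real_derivative 0 + h t) (at t within {t0..})"
      unfolding N_def
      by (intro DERIV_add DERIV_const integral_has_derivative_half_line cont_h \<open>t \<ge> t0\<close>)
    show "(X has_real_derivative
        p t * X t + spectral_norm (W t) * spectral_norm (matrix_inv (W t)) * norm (f t (y t)))
        (at t within {t0..})"
      using DERIV_mult[OF dW dN] unfolding X_def h_def
      by (simp add: algebra_simps)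
  qed
qed

section \<open>The stability and boundedness theorem\<close>

theorem theorem3:
  fixes t0 :: real
    and A W :: "real \<Rightarrow> real^'n^'n"
    and f :: "real \<Rightarrow> real^'n \<Rightarrow> real^'n"
    and x :: "real \<Rightarrow> real^'n \<Rightarrow> real^'n"
    and \<Omega> :: "(real^'n) set"
    and L :: "real \<Rightarrow> real \<Rightarrow> real"
    and Lhat :: "real \<Rightarrow> real"
    and p k :: "real \<Rightarrow> real"
    and phat khat d \<sigma>bar \<sigma>low :: real
  assumes A_C1: "\<exists>A'. continuous_on {t0..} A' \<and>
        (\<forall>t\<ge>t0. (A has_vector_derivative A' t) (at t within {t0..}))"
    and A_bounded: "bounded (A ` {t0..})"
    and f_cont: "continuous_on ({t0..} \<times> UNIV) (\<lambda>(t, z). f t z)"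
    and f_bounded: "bounded ((\<lambda>(t, z). f t z) ` ({t0..} \<times> UNIV))"
    and f_zero: "\<And>t. t \<ge> t0 \<Longrightarrow> f t 0 = 0"
    and system_unique: "uniquely_solvable (\<lambda>t z. A t *v z + f t z) t0 UNIV"
    and x_solution: "\<And>x0. solves_ode (\<lambda>t z. A t *v z + f t z) t0 UNIV (\<lambda>t. x t x0) \<and> x t0 x0 = x0"
    and W_fundamental: "fundamental_matrix A t0 W"
    and W_normalized: "spectral_norm (W t0) = 1"
    and sigma_simple: "\<And>t. t \<ge> t0 \<Longrightarrow> sigma_max_simple (W t)"
    and sigma_upper: "\<And>t. t \<ge> t0 \<Longrightarrow> sigma_max (W t) \<le> \<sigma>bar"
    and sigma_lower: "\<And>t. t \<ge> t0 \<Longrightarrow> \<sigma>low \<le> sigma_min (W t)"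
    and p_def: "\<And>t. t \<ge> t0 \<Longrightarrow>
        ((\<lambda>s. ln (spectral_norm (W s))) has_real_derivative p t) (at t within {t0..})"
    and p_cont: "continuous_on {t0..} p"
    and k_def: "\<And>t. t \<ge> t0 \<Longrightarrow> k t = spectral_norm (W t) * spectral_norm (matrix_inv (W t))"
    and k_cont: "continuous_on {t0..} k"
    and k_bounded: "bounded (k ` {t0..})"
    and Omega_nhd: "0 \<in> interior \<Omega>"
    and L_cont: "continuous_on ({t0..} \<times> {0..}) (\<lambda>(t, X). L t X)"
    and f_le_L: "\<And>t z. t \<ge> t0 \<Longrightarrow> z \<in> \<Omega> \<Longrightarrow> norm (f t z) \<le> L t (norm z)"
    and auxiliary_unique: "uniquely_solvable (\<lambda>t X. p t * X + k t * L t X) t0 {0..}"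
    and p_bdd_above: "bdd_above (p ` {t0..})"
    and phat_def: "phat = (SUP t\<in>{t0..}. p t)"
    and khat_def: "khat = (SUP t\<in>{t0..}. k t)"
    and L_bdd_above: "\<And>X. X \<ge> 0 \<Longrightarrow> bdd_above ((\<lambda>t. L t X) ` {t0..})"
    and Lhat_def: "\<And>X. X \<ge> 0 \<Longrightarrow> Lhat X = (SUP t\<in>{t0..}. L t X)"
    and Lhat_zero: "Lhat 0 = 0"
    and Lhat_cont: "continuous_on {0..} Lhat"
    and autonomous_unique: "uniquely_solvable (\<lambda>t X. phat * X + khat * Lhat X) t0 {0..}"
    and phat_neg: "phat < 0"
    and Lhat_mono: "mono_on {0..} Lhat"
    and d_pos: "d > 0"
    and d_fixed: "fixed_solution (\<lambda>t X. phat * X + khat * Lhat X) t0 {0..} d"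
    and d_unique: "\<And>c. c > 0 \<Longrightarrow>
        fixed_solution (\<lambda>t X. phat * X + khat * Lhat X) t0 {0..} c \<Longrightarrow> c = d"
  shows "(\<not> stable_solution (\<lambda>t X. phat * X + khat * Lhat X) t0 {0..} {0..d} (\<lambda>_. d) \<longrightarrow>
            asymptotically_stable_solution (\<lambda>t z. A t *v z + f t z) t0 UNIV (\<lambda>_. 0) \<and>
            (\<forall>x0\<in>omega W t0 d. (\<forall>t\<ge>t0. x t x0 \<in> \<Omega>) \<longrightarrow>
               (\<forall>t\<ge>t0. norm (x t x0) \<le> d) \<and>
               (norm (matrix_inv (W t0) *v x0) < d \<longrightarrow>
                  ((\<lambda>t. norm (x t x0)) \<longlongrightarrow> 0) at_top \<and> x0 \<in> stability_basin x)))
       \<and> (stable_solution (\<lambda>t X. phat * X + khat * Lhat X) t0 {0..} {0..} (\<lambda>_. d) \<longrightarrow>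
            (\<forall>x0\<in>omega W t0 d. (\<forall>t\<ge>t0. x t x0 \<in> \<Omega>) \<longrightarrow>
               (\<forall>t\<ge>t0. norm (x t x0) \<le> d)) \<and>
            (\<forall>x0. (\<forall>t\<ge>t0. x t x0 \<in> \<Omega>) \<longrightarrow>
               Limsup at_top (\<lambda>t. ereal (norm (x t x0))) \<le> ereal d))"
proof -
  define g where "g X = phat * X + khat * Lhat X" for X
  let ?F = "\<lambda>t z. A t *v z + f t z"
  have invW: "invertible (W t)" if "t \<ge> t0" for t
    using W_fundamental that by (simp add: fundamental_matrix_def)
  \<comment> \<open>Dividing the condition number by the norm of \<open>W\<close> avoids any continuity argument for the
    inverse. The detour through \<open>exp (ln _)\<close> makes the denominator continuous and nonzero.\<close>
  have inv_cont: "continuous_on {t0..} (\<lambda>s. spectral_norm (matrix_inv (W s)))"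
  proof -
    have "continuous_on {t0..} (\<lambda>s. k s / exp (ln (spectral_norm (W s))))"
      by (intro continuous_intros k_cont continuous_on_half_line[OF p_def]) auto
    then show ?thesis
      by (rule continuous_on_eq) (use spectral_norm_pos[OF invW] in \<open>force simp: k_def\<close>)
  qed
  have p_le: "p t \<le> phat" if "t \<ge> t0" for t
    unfolding phat_def by (rule cSUP_upper[OF _ p_bdd_above]) (use that in auto)
  have k_le: "k t \<le> khat" if "t \<ge> t0" for t
    unfolding khat_def
    by (rule cSUP_upper[OF _ bounded_imp_bdd_above[OF k_bounded]]) (use that in auto)
  have k_nonneg: "0 \<le> k t" if "t \<ge> t0" for t
    using that by (simp add: k_def spectral_norm_nonneg)
  have L_le: "L t X \<le> Lhat X" if "t \<ge> t0" "X \<ge> 0" for t X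
    unfolding Lhat_def[OF that(2)]
    by (rule cSUP_upper[OF _ L_bdd_above[OF that(2)]]) (use that in auto)
  \<comment> \<open>The bound on \<open>f\<close> turns the equation of the majorant into \<open>X' \<le> g X\<close> at every time at
    which the solution is in \<open>\<Omega>\<close>; monotonicity of \<open>Lhat\<close> replaces the norm by \<open>X\<close>.\<close>
  have majorant: "\<exists>X X'. X t0 = norm (matrix_inv (W t0) *v y t0) \<and>
      (\<forall>t\<ge>t0. norm (y t) \<le> X t) \<and>
      (\<forall>t\<ge>t0. (X has_real_derivative X' t) (at t within {t0..})) \<and>
      (\<forall>t\<ge>t0. y t \<in> \<Omega> \<longrightarrow> X' t \<le> g (X t))"
    if y: "solves_ode ?F t0 UNIV y" for y
  proof -
    obtain X where init: "X t0 = spectral_norm (W t0) * norm (matrix_inv (W t0) *v y t0)"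
      and le: "\<And>t. t \<ge> t0 \<Longrightarrow> norm (y t) \<le> X t"
      and deriv: "\<And>t. t \<ge> t0 \<Longrightarrow> (X has_real_derivative
        p t * X t + spectral_norm (W t) * spectral_norm (matrix_inv (W t)) * norm (f t (y t)))
        (at t within {t0..})"
      using scalar_majorant[OF W_fundamental p_def inv_cont f_cont y] by blast
    have "p t * X t + spectral_norm (W t) * spectral_norm (matrix_inv (W t)) * norm (f t (y t)) \<le> g (X t)"
      if "t \<ge> t0" "y t \<in> \<Omega>" for t
    proof -
      have X: "0 \<le> X t"
        using le[OF that(1)] norm_ge_zero[of "y t"] by linarith
      have "norm (f t (y t)) \<le> Lhat (norm (y t))"
        using f_le_L[OF that] L_le[OF that(1), of "norm (y t)"] by simp
      also have "\<dots> \<le> Lhat (X t)"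
        using mono_onD[OF Lhat_mono] le[OF that(1)] X by simp
      finally have "k t * norm (f t (y t)) \<le> khat * Lhat (X t)"
        using k_le k_nonneg that(1) by (intro mult_mono) (auto intro: order_trans)
      moreover have "p t * X t \<le> phat * X t"
        using p_le[OF that(1)] X by (rule mult_right_mono)
      ultimately show ?thesis
        using k_def[OF that(1)] by (simp add: g_def)
    qed
    then show ?thesis
      using init W_normalized le deriv by (intro exI[of _ X] exI[of _ "\<lambda>t. p t * X t
          + spectral_norm (W t) * spectral_norm (matrix_inv (W t)) * norm (f t (y t))"]) auto
  qed
  have d_zero: "g d = 0"
  proof -
    have "((\<lambda>_. d) has_real_derivative g d) (at (t0 + 1) within {t0..})"
      using solves_ode_real_derivative[OF d_fixed[unfolded fixed_solution_def], of "t0 + 1"]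
      by (simp add: g_def)
    moreover have "at (t0 + 1) within {t0..} = at (t0 + 1)"
      by (rule at_within_interior) simp
    ultimately show ?thesis
      using DERIV_unique[OF _ DERIV_const] by force
  qed
  have zero_unique: "c = d" if "c > 0" "g c = 0" for c
    using that by (intro d_unique) (simp_all add: fixed_solution_def solves_ode_def g_def)
  have g_cont: "continuous_on {0..} g"
    unfolding g_def by (intro continuous_intros Lhat_cont)
  have uniq: "uniquely_solvable (\<lambda>t. g) t0 {0..}"
    using autonomous_unique by (simp add: g_def[abs_def])
  have sign: "(\<forall>u\<in>S. g u < 0) \<or> (\<forall>u\<in>S. g u > 0)"
    if "is_interval S" "S \<subseteq> {0<..}" "d \<notin> S" for S
  proof (rule continuous_nonzero_sign[OF that(1)])
    show "continuous_on S g"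
      by (rule continuous_on_subset[OF g_cont]) (use that(2) in force)
    show "g u \<noteq> 0" if "u \<in> S" for u
      using zero_unique[of u] that \<open>S \<subseteq> {0<..}\<close> \<open>d \<notin> S\<close> by auto
  qed
  have sign_above: "(\<forall>u\<in>{d<..}. g u < 0) \<or> (\<forall>u\<in>{d<..}. g u > 0)"
    by (rule sign) (use d_pos in \<open>auto simp: is_interval_1\<close>)
  have sign_below: "(\<forall>u\<in>{0<..<d}. g u < 0) \<or> (\<forall>u\<in>{0<..<d}. g u > 0)"
    by (rule sign) (auto simp: is_interval_1)
  have solution_bound: "norm (x t x0) \<le> d"
    if x0: "x0 \<in> omega W t0 d" "\<forall>t\<ge>t0. x t x0 \<in> \<Omega>" and "t \<ge> t0" for x0 t
  proof -
    obtain X X' where X: "X t0 = norm (matrix_inv (W t0) *v x0)"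
      "\<And>t. t \<ge> t0 \<Longrightarrow> norm (x t x0) \<le> X t"
      "\<And>t. t \<ge> t0 \<Longrightarrow> (X has_real_derivative X' t) (at t within {t0..})"
      "\<And>t. t \<ge> t0 \<Longrightarrow> X' t \<le> g (X t)"
      using majorant[of "\<lambda>t. x t x0"] x_solution[of x0] x0(2) by auto
    have "X t \<le> d"
    proof (rule never_above_equilibrium[OF uniq g_cont _ d_zero _ X(3,4)])
      show "X t0 \<le> d" using x0(1) X(1) by (simp add: omega_def)
    qed (use d_pos sign_above \<open>t \<ge> t0\<close> in auto)
    then show ?thesis using X(2)[OF \<open>t \<ge> t0\<close>] by simp
  qed
  have part1: "asymptotically_stable_solution ?F t0 UNIV (\<lambda>_. 0) \<and>
      (\<forall>x0\<in>omega W t0 d. (\<forall>t\<ge>t0. x t x0 \<in> \<Omega>) \<longrightarrow>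
        norm (matrix_inv (W t0) *v x0) < d \<longrightarrow> ((\<lambda>t. norm (x t x0)) \<longlongrightarrow> 0) at_top)"
    if unstable: "\<not> stable_solution (\<lambda>t. g) t0 {0..} {0..d} (\<lambda>_. d)"
  proof -
    have neg: "g u < 0" if "0 < u" "u < d" for u
      using unstable_imp_negative_below[OF uniq d_pos d_zero sign_below unstable that] .
    have attracted: "((\<lambda>t. norm (y t)) \<longlongrightarrow> 0) at_top"
      if y: "solves_ode ?F t0 UNIV y" "\<And>t. t \<ge> t0 \<Longrightarrow> y t \<in> \<Omega>"
        "norm (matrix_inv (W t0) *v y t0) < d" for y
    proof -
      obtain X X' where X: "X t0 = norm (matrix_inv (W t0) *v y t0)"
        "\<And>t. t \<ge> t0 \<Longrightarrow> norm (y t) \<le> X t"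
        "\<And>t. t \<ge> t0 \<Longrightarrow> (X has_real_derivative X' t) (at t within {t0..})"
        "\<And>t. t \<ge> t0 \<Longrightarrow> X' t \<le> g (X t)"
        using majorant[OF y(1)] y(2) by auto
      have "continuous_on {0<..<d} g"
        by (rule continuous_on_subset[OF g_cont]) auto
      then have small: "\<forall>\<^sub>F t in at_top. X t \<le> c" if "c > 0" for c
        using eventually_le_level[OF X(3,4), where a=0 and b=d and c=c] neg X(1) y(3) d_pos that
        by simp
      show ?thesis
      proof (rule tendstoI)
        fix e :: real assume "e > 0"
        then have "\<forall>\<^sub>F t in at_top. X t \<le> e / 2" by (intro small) simp
        then show "\<forall>\<^sub>F t in at_top. dist (norm (y t)) 0 < e"
          using eventually_ge_at_top[of t0]
        proof eventually_elim
          case (elim t)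
          then show ?case using X(2)[of t] \<open>e > 0\<close> by simp
        qed
      qed
    qed
    \<comment> \<open>A solution starting close to \<open>0\<close> is not assumed to stay in \<open>\<Omega>\<close>. It does, because while
      \<open>X < c\<close> the solution lies in \<open>ball 0 c\<close>, where the differential inequality holds and forbids
      \<open>X\<close> to increase.\<close>
    have confined: "norm (y t) < c"
      if y: "solves_ode ?F t0 UNIV y" "norm (matrix_inv (W t0) *v y t0) < c"
        and c: "c \<le> d" "ball 0 c \<subseteq> \<Omega>" and t: "t \<ge> t0" for y t c
    proof (rule ccontr)
      assume "\<not> norm (y t) < c"
      obtain X X' where X: "X t0 = norm (matrix_inv (W t0) *v y t0)"
        "\<And>t. t \<ge> t0 \<Longrightarrow> norm (y t) \<le> X t"
        "\<And>t. t \<ge> t0 \<Longrightarrow> (X has_real_derivative X' t) (at t within {t0..})"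
        "\<And>t. t \<ge> t0 \<Longrightarrow> y t \<in> \<Omega> \<Longrightarrow> X' t \<le> g (X t)"
        using majorant[OF y(1)] by auto
      have "X t0 < c" "c \<le> X t"
        using X(1) X(2)[OF t] y(2) \<open>\<not> norm (y t) < c\<close> by auto
      obtain \<xi> where \<xi>: "t0 < \<xi>" "X t0 < X \<xi>" "X \<xi> < c" "X' \<xi> > 0"
        using up_crossing[OF X(3) order.refl t order.refl \<open>X t0 < c\<close> \<open>c \<le> X t\<close>] by metis
      have "y \<xi> \<in> \<Omega>" using X(2)[of \<xi>] \<xi> c(2) by auto
      moreover have "g (X \<xi>) < 0"
        using neg[of "X \<xi>"] \<xi> X(1) c(1) norm_ge_zero[of "matrix_inv (W t0) *v y t0"] by linarith
      ultimately show False using X(4)[of \<xi>] \<xi> by auto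
    qed
    obtain r where r: "r > 0" "ball 0 r \<subseteq> \<Omega>"
      using Omega_nhd by (auto simp: mem_interior)
    define C where "C = spectral_norm (matrix_inv (W t0)) + 1"
    have C: "C > 0" using spectral_norm_nonneg[of "matrix_inv (W t0)"] by (simp add: C_def)
    have initial: "norm (matrix_inv (W t0) *v z) < c" if "norm z < c / C" for z c
    proof -
      have "norm (matrix_inv (W t0) *v z) \<le> spectral_norm (matrix_inv (W t0)) * norm z"
        by (rule norm_matrix_vector_le)
      also have "\<dots> \<le> C * norm z" by (simp add: C_def mult_right_mono)
      also have "\<dots> < c" using that C by (simp add: field_simps)
      finally show ?thesis .
    qed
    have confined_small: "norm (y t) < min \<epsilon> (min d r)"
      if "\<epsilon> > 0" "solves_ode ?F t0 UNIV y" "norm (y t0) < min \<epsilon> (min d r) / C" "t \<ge> t0" for \<epsilon> y t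
      by (rule confined[OF that(2) initial[OF that(3)] _ _ that(4)]) (use r(2) in auto)
    have "stable_solution ?F t0 UNIV UNIV (\<lambda>_. 0)"
      unfolding stable_solution_def
    proof (intro allI impI)
      fix \<epsilon> :: real assume "\<epsilon> > 0"
      then have "min \<epsilon> (min d r) / C > 0" using d_pos r C by simp
      then show "\<exists>\<delta>>0. \<forall>y. solves_ode ?F t0 UNIV y \<and> y t0 \<in> UNIV \<and> dist (y t0) 0 < \<delta>
          \<longrightarrow> (\<forall>t\<ge>t0. dist (y t) 0 < \<epsilon>)"
        using confined_small[OF \<open>\<epsilon> > 0\<close>] by (intro exI[of _ "min \<epsilon> (min d r) / C"]) auto
    qed
    moreover have "\<exists>\<eta>>0. \<forall>y. solves_ode ?F t0 UNIV y \<and> dist (y t0) 0 < \<eta>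
        \<longrightarrow> ((\<lambda>t. dist (y t) 0) \<longlongrightarrow> 0) at_top"
    proof (intro exI conjI allI impI)
      show "min d (min d r) / C > 0" using d_pos r C by simp
      fix y assume y: "solves_ode ?F t0 UNIV y \<and> dist (y t0) 0 < min d (min d r) / C"
      have "y t \<in> \<Omega>" if "t \<ge> t0" for t
        using confined_small[OF d_pos, of y t] y that r(2) by auto
      moreover have "norm (matrix_inv (W t0) *v y t0) < d"
        using initial[of "y t0" "min d (min d r)"] y by simp
      ultimately show "((\<lambda>t. dist (y t) 0) \<longlongrightarrow> 0) at_top"
        using attracted[of y] y by simp
    qed
    ultimately have "asymptotically_stable_solution ?F t0 UNIV (\<lambda>_. 0)"
      unfolding asymptotically_stable_solution_def by blast
    moreover have "((\<lambda>t. norm (x t x0)) \<longlongrightarrow> 0) at_top"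
      if "\<forall>t\<ge>t0. x t x0 \<in> \<Omega>" "norm (matrix_inv (W t0) *v x0) < d" for x0
      using attracted[of "\<lambda>t. x t x0"] x_solution[of x0] that by simp
    ultimately show ?thesis by blast
  qed
  have part2: "Limsup at_top (\<lambda>t. ereal (norm (x t x0))) \<le> ereal d"
    if stable: "stable_solution (\<lambda>t. g) t0 {0..} {0..} (\<lambda>_. d)"
      and x0: "\<forall>t\<ge>t0. x t x0 \<in> \<Omega>" for x0
  proof -
    have neg: "g u < 0" if "u > d" for u
      by (rule stable_imp_negative_above[OF uniq g_cont _ sign_above stable that]) (use d_pos in simp)
    obtain X X' where X: "X t0 = norm (matrix_inv (W t0) *v x0)"
      "\<And>t. t \<ge> t0 \<Longrightarrow> norm (x t x0) \<le> X t"
      "\<And>t. t \<ge> t0 \<Longrightarrow> (X has_real_derivative X' t) (at t within {t0..})"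
      "\<And>t. t \<ge> t0 \<Longrightarrow> X' t \<le> g (X t)"
      using majorant[of "\<lambda>t. x t x0"] x_solution[of x0] x0 by auto
    \<comment> \<open>Any bound above both \<open>X t0\<close> and \<open>d\<close> serves, as \<open>g\<close> is negative on all of \<open>{d<..}\<close>.\<close>
    define b where "b = max (X t0) d + 1"
    have "continuous_on {d<..<b} g"
      by (rule continuous_on_subset[OF g_cont]) (use d_pos in auto)
    then have small: "\<forall>\<^sub>F t in at_top. X t \<le> c" if "c > d" for c
      using eventually_le_level[OF X(3,4), where a=d and b=b and c=c] neg that
      by (simp add: b_def)
    show ?thesis
    proof (rule Limsup_le_iff[THEN iffD2, rule_format])
      fix e assume "ereal d < e"
      then obtain c where c: "ereal d < ereal c" "ereal c < e"
        using ereal_dense2 by blast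
      have "\<forall>\<^sub>F t in at_top. X t \<le> c" using c by (intro small) simp
      then show "\<forall>\<^sub>F t in at_top. ereal (norm (x t x0)) < e"
        using eventually_ge_at_top[of t0]
      proof eventually_elim
        case (elim t)
        then have "ereal (norm (x t x0)) \<le> ereal c" using X(2)[of t] by simp
        then show ?case using c(2) by (rule order.strict_trans1)
      qed
    qed
  qed
  have eq: "(\<lambda>t X. phat * X + khat * Lhat X) = (\<lambda>t. g)"
    by (simp add: g_def[abs_def])
  show ?thesis
    unfolding eq using part1 part2 solution_bound
    by (auto simp: stability_basin_def tendsto_norm_zero_iff)
qed

end
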